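(* Let $(X,M,\ast)$ be a compact fuzzy metric space, where $\ast$ is the \L ukasiewicz t-norm, and let $\hat M$ be the fuzzy Prokhorov metric on the set $P(X)$ of Borel probability measures on $X$. Let $\mu\in P(X)$ and let $(\mu_i)_{i\in\mathbb N}$ be a sequence in $P(X)$ that weakly* converges to $\mu$. Then $(\mu_i)$ converges to $\mu$ in the topology induced by the fuzzy metric $\hat M$.
   Context: The \L ukasiewicz t-norm is $x\ast y=\max\{x+y-1,0\}$ for $x,y\in[0,1]$. A fuzzy metric (in the sense of George and Veeramani) with respect to $\ast$ on a set $Z$ is a function $N\colon Z\times Z\times(0,\infty)\to[0,1]$ such that for all $x,y,z\in Z$ and $s,t>0$: (i) $N(x,y,t)>0$; (ii) $N(x,y,t)=1$ if and only if $x=y$; (iii) $N(x,y,t)=N(y,x,t)$; (iv) $N(x,y,t)\ast N(y,z,s)\le N(x,z,t+s)$; (v) $N(x,y,-)\colon(0,\infty)\to(0,1]$ is continuous. Then $(Z,N,\ast)$ is called a fuzzy metric space. The open balls $\{y\in Z\mid N(x,y,t)>1-r\}$, $x\in Z$, $r\in(0,1)$, $t>0$, form a base of a (metrizable) topology $\tau_N$ on $Z$, the topology induced by $N$. For the fuzzy metric space $(X,M,\ast)$ write $B(x,r,t)=\{y\in X\mid M(x,y,t)>1-r\}$; compactness, continuity and Borel sets in $X$ refer to $\tau_M$. For $A\subset X$, $A^{r,t}=\bigcup\{B(x,r,t)\mid x\in A\}$. The fuzzy Prokhorov metric $\hat M\colon P(X)\times P(X)\times(0,\infty)\to[0,1]$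 is $$\hat M(\mu,\nu,t)=1-\inf\{r\in(0,1)\mid \mu(A)\le\nu(A^{r,t})+r \text{ and } \nu(A)\le\mu(A^{r,t})+r \text{ for every Borel } A\subset X\};$$ it is well defined and is a fuzzy metric on $P(X)$ with respect to $\ast$. $(\mu_i)$ weakly* converges to $\mu$ if $\lim_{i\to\infty}\int_X\varphi\,d\mu_i=\int_X\varphi\,d\mu$ for every continuous $\varphi\colon X\to\mathbb R$. *)

theory Defs
  imports "HOL-Probability.Probability"
begin

definition luk_tnorm :: "real \<Rightarrow> real \<Rightarrow> real" where
  "luk_tnorm x y = max (x + y - 1) 0"

(* N is only constrained on Z x Z x (0,\<infinity>); its values elsewhere are irrelevant. *)
definition fuzzy_metric_on :: "'a set \<Rightarrow> ('a \<Rightarrow> 'a \<Rightarrow> real \<Rightarrow> real) \<Rightarrow> bool" where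
  "fuzzy_metric_on Z N \<longleftrightarrow>
     (\<forall>x\<in>Z. \<forall>y\<in>Z. \<forall>t>0. 0 \<le> N x y t \<and> N x y t \<le> 1) \<and>
     (\<forall>x\<in>Z. \<forall>y\<in>Z. \<forall>t>0. N x y t > 0) \<and>
     (\<forall>x\<in>Z. \<forall>y\<in>Z. \<forall>t>0. N x y t = 1 \<longleftrightarrow> x = y) \<and>
     (\<forall>x\<in>Z. \<forall>y\<in>Z. \<forall>t>0. N x y t = N y x t) \<and>
     (\<forall>x\<in>Z. \<forall>y\<in>Z. \<forall>z\<in>Z. \<forall>s>0. \<forall>t>0. luk_tnorm (N x y t) (N y z s) \<le> N x z (t + s)) \<and>
     (\<forall>x\<in>Z. \<forall>y\<in>Z. continuous_on {0<..} (N x y))"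

definition fuzzy_ball ::
    "'a set \<Rightarrow> ('a \<Rightarrow> 'a \<Rightarrow> real \<Rightarrow> real) \<Rightarrow> 'a \<Rightarrow> real \<Rightarrow> real \<Rightarrow> 'a set" where
  "fuzzy_ball Z N x r t = {y \<in> Z. N x y t > 1 - r}"

(* For a fuzzy metric the balls are a base of this topology, not merely a subbase:
   see openin_fuzzy_topology_iff below. *)
definition fuzzy_topology ::
    "'a set \<Rightarrow> ('a \<Rightarrow> 'a \<Rightarrow> real \<Rightarrow> real) \<Rightarrow> 'a topology" where
  "fuzzy_topology Z N =
     topology_generated_by {fuzzy_ball Z N x r t | x r t. x \<in> Z \<and> 0 < r \<and> r < 1 \<and> 0 < t}"

definition fuzzy_nbhd ::
    "'a set \<Rightarrow> ('a \<Rightarrow> 'a \<Rightarrow> real \<Rightarrow> real) \<Rightarrow> 'a set \<Rightarrow> real \<Rightarrow> real \<Rightarrow> 'a set" where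
  "fuzzy_nbhd X M A r t = (\<Union>x\<in>A. fuzzy_ball X M x r t)"

definition fuzzy_borel :: "'a set \<Rightarrow> ('a \<Rightarrow> 'a \<Rightarrow> real \<Rightarrow> real) \<Rightarrow> 'a measure" where
  "fuzzy_borel X M = sigma X {U. openin (fuzzy_topology X M) U}"

definition borel_prob_measures ::
    "'a set \<Rightarrow> ('a \<Rightarrow> 'a \<Rightarrow> real \<Rightarrow> real) \<Rightarrow> 'a measure set" where
  "borel_prob_measures X M =
     {\<mu>. prob_space \<mu> \<and> space \<mu> = X \<and> sets \<mu> = sets (fuzzy_borel X M)}"

(* For compact X the set below is nonempty (M is bounded away from 0 at each t > 0),
   so the infimum is a genuine one. *)
definition fuzzy_prokhorov ::
    "'a set \<Rightarrow> ('a \<Rightarrow> 'a \<Rightarrow> real \<Rightarrow> real) \<Rightarrow> 'a measure \<Rightarrow> 'a measure \<Rightarrow> real \<Rightarrow> real" where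
  "fuzzy_prokhorov X M \<mu> \<nu> t =
     1 - Inf {r. 0 < r \<and> r < 1 \<and>
                 (\<forall>A\<in>sets (fuzzy_borel X M).
                    measure \<mu> A \<le> measure \<nu> (fuzzy_nbhd X M A r t) + r \<and>
                    measure \<nu> A \<le> measure \<mu> (fuzzy_nbhd X M A r t) + r)}"

definition weak_star_converges ::
    "'a set \<Rightarrow> ('a \<Rightarrow> 'a \<Rightarrow> real \<Rightarrow> real) \<Rightarrow> (nat \<Rightarrow> 'a measure) \<Rightarrow> 'a measure \<Rightarrow> bool" where
  "weak_star_converges X M \<mu>s \<mu> \<longleftrightarrow>
     (\<forall>\<phi>. continuous_map (fuzzy_topology X M) euclideanreal \<phi> \<longrightarrow>
          (\<lambda>i. integral\<^sup>L (\<mu>s i) \<phi>) \<longlonglongrightarrow> integral\<^sup>L \<mu> \<phi>)"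

lemma fuzzy_metric_on_mono:
  assumes N: "fuzzy_metric_on Z N" and xy: "x \<in> Z" "y \<in> Z" and st: "0 < s" "s \<le> t"
  shows "N x y s \<le> N x y t"
proof (cases "s = t")
  case False
  then have d: "t - s > 0" using st by simp
  have "luk_tnorm (N x y s) (N y y (t - s)) \<le> N x y (s + (t - s))"
    using N xy st d unfolding fuzzy_metric_on_def by blast
  moreover have "N y y (t - s) = 1"
    using N xy d unfolding fuzzy_metric_on_def by blast
  ultimately show ?thesis by (simp add: luk_tnorm_def)
qed simp

lemma fuzzy_ball_contains_ball:
  assumes N: "fuzzy_metric_on Z N" and x: "x \<in> Z" and t: "0 < t"
    and y: "y \<in> fuzzy_ball Z N x r t"
  shows "\<exists>q u. 0 < q \<and> q < 1 \<and> 0 < u \<and> fuzzy_ball Z N y q u \<subseteq> fuzzy_ball Z N x r t"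
proof -
  have yZ: "y \<in> Z" and yr: "N x y t > 1 - r" using y by (auto simp: fuzzy_ball_def)
  have "continuous_on {0<..} (N x y)" using N x yZ unfolding fuzzy_metric_on_def by blast
  then have "isCont (N x y) t" using t by (simp add: continuous_on_eq_continuous_at)
  then have "(N x y \<longlongrightarrow> N x y t) (at_left t)"
    by (simp add: isCont_def filterlim_at_split)
  then have "\<forall>\<^sub>F s in at_left t. N x y s > 1 - r"
    using yr by (rule order_tendstoD)
  moreover have "\<forall>\<^sub>F s in at_left t. s \<in> {0<..<t}"
    by (rule eventually_at_leftI[of 0]) (use t in auto)
  ultimately have "\<forall>\<^sub>F s in at_left t. N x y s > 1 - r \<and> s \<in> {0<..<t}"
    by (rule eventually_conj)
  then obtain s where s: "N x y s > 1 - r" "0 < s" "s < t"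
    using eventually_happens'[of "at_left t"] by (auto simp: trivial_limit_at_left_real)
  define q where "q = min (1/2) (N x y s - (1 - r))"
  have "fuzzy_ball Z N y q (t - s) \<subseteq> fuzzy_ball Z N x r t"
  proof
    fix z assume "z \<in> fuzzy_ball Z N y q (t - s)"
    then have z: "z \<in> Z" "N y z (t - s) > 1 - q" by (auto simp: fuzzy_ball_def)
    have d: "t - s > 0" using s by simp
    have "luk_tnorm (N x y s) (N y z (t - s)) \<le> N x z (s + (t - s))"
      using N x yZ z(1) s(2) d unfolding fuzzy_metric_on_def by blast
    then have "N x y s + N y z (t - s) - 1 \<le> N x z t" by (simp add: luk_tnorm_def)
    then show "z \<in> fuzzy_ball Z N x r t" using z by (auto simp: fuzzy_ball_def q_def)
  qed
  moreover have "0 < q" "q < 1" "0 < t - s" using s by (auto simp: q_def)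
  ultimately show ?thesis by blast
qed

lemma fuzzy_ball_centre:
  assumes "fuzzy_metric_on Z N" "x \<in> Z" "0 < r" "0 < t"
  shows "x \<in> fuzzy_ball Z N x r t"
proof -
  have "N x x t = 1" using assms unfolding fuzzy_metric_on_def by blast
  then show ?thesis using assms by (simp add: fuzzy_ball_def)
qed

lemma openin_fuzzy_topology_iff:
  assumes N: "fuzzy_metric_on Z N"
  shows "openin (fuzzy_topology Z N) U \<longleftrightarrow>
    U \<subseteq> Z \<and> (\<forall>x\<in>U. \<exists>r t. 0 < r \<and> r < 1 \<and> 0 < t \<and> fuzzy_ball Z N x r t \<subseteq> U)"
    (is "_ \<longleftrightarrow> ?R U")
proof
  let ?S = "{fuzzy_ball Z N x r t | x r t. x \<in> Z \<and> 0 < r \<and> r < 1 \<and> 0 < t}"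
  assume "openin (fuzzy_topology Z N) U"
  then have "generate_topology_on ?S U"
    by (simp add: fuzzy_topology_def openin_topology_generated_by)
  then show "?R U"
  proof induction
    case Empty
    show ?case by simp
  next
    case (Int a b)
    show ?case
    proof (intro conjI ballI)
      show "a \<inter> b \<subseteq> Z" using Int by blast
      fix x assume x: "x \<in> a \<inter> b"
      obtain r t where r: "0 < r" "r < 1" "0 < t" "fuzzy_ball Z N x r t \<subseteq> a"
        using Int x by blast
      obtain q u where q: "0 < q" "q < 1" "0 < u" "fuzzy_ball Z N x q u \<subseteq> b"
        using Int x by blast
      have xZ: "x \<in> Z" using Int x by blast
      have "fuzzy_ball Z N x (min r q) (min t u) \<subseteq> fuzzy_ball Z N x r t \<inter> fuzzy_ball Z N x q u"
      proof
        fix y assume y: "y \<in> fuzzy_ball Z N x (min r q) (min t u)"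
        then have yZ: "y \<in> Z" by (simp add: fuzzy_ball_def)
        have "N x y (min t u) \<le> N x y t" "N x y (min t u) \<le> N x y u"
          using fuzzy_metric_on_mono[OF N xZ yZ] r q by auto
        then show "y \<in> fuzzy_ball Z N x r t \<inter> fuzzy_ball Z N x q u"
          using y by (auto simp: fuzzy_ball_def)
      qed
      then show "\<exists>r t. 0 < r \<and> r < 1 \<and> 0 < t \<and> fuzzy_ball Z N x r t \<subseteq> a \<inter> b"
        using r q by (intro exI[of _ "min r q"] exI[of _ "min t u"]) auto
    qed
  next
    case (UN K)
    show ?case
    proof (intro conjI ballI)
      show "\<Union>K \<subseteq> Z" using UN by blast
      fix x assume "x \<in> \<Union>K"
      then obtain k where "k \<in> K" "x \<in> k" by blast
      then show "\<exists>r t. 0 < r \<and> r < 1 \<and> 0 < t \<and> fuzzy_ball Z N x r t \<subseteq> \<Union>K"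
        using UN.IH[of k] by (meson Union_upper order_trans)
    qed
  next
    case (Basis s)
    then obtain x r t where s: "s = fuzzy_ball Z N x r t" "x \<in> Z" "0 < t" by blast
    have "s \<subseteq> Z" unfolding s(1) fuzzy_ball_def by blast
    then show ?case
      using fuzzy_ball_contains_ball[OF N s(2,3)] unfolding s(1) by blast
  qed
next
  assume R: "?R U"
  have "openin (fuzzy_topology Z N) (\<Union>{fuzzy_ball Z N x r t | x r t.
      x \<in> Z \<and> 0 < r \<and> r < 1 \<and> 0 < t \<and> fuzzy_ball Z N x r t \<subseteq> U})"
    unfolding fuzzy_topology_def
    by (rule openin_Union) (auto intro!: topology_generated_by_Basis)
  also have "\<Union>{fuzzy_ball Z N x r t | x r t.
      x \<in> Z \<and> 0 < r \<and> r < 1 \<and> 0 < t \<and> fuzzy_ball Z N x r t \<subseteq> U} = U"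
    (is "?V = U")
  proof
    show "U \<subseteq> ?V"
    proof
      fix x assume x: "x \<in> U"
      then obtain r t where r: "0 < r" "r < 1" "0 < t" "fuzzy_ball Z N x r t \<subseteq> U"
        using R by blast
      moreover have xZ: "x \<in> Z" using R x by blast
      ultimately show "x \<in> ?V" using fuzzy_ball_centre[OF N xZ r(1,3)] by blast
    qed
  qed blast
  finally show "openin (fuzzy_topology Z N) U" .
qed

end

theory Submission
  imports Defs
begin

text \<open>
  Weak* convergence controls the integrals of finitely many continuous functions. By compactness
  \<open>X\<close> is covered by finitely many small balls \<open>B(c, r/4, t/2)\<close>; for each set \<open>J\<close> of their centres
  let \<open>\<phi>\<^sub>J\<close> be a continuous function that is \<open>1\<close> on the union of these balls and \<open>0\<close> off the union
  of the larger balls \<open>B(c, r/2, t/2)\<close>. If \<open>J\<close> consists of the centres whose small ball meets \<open>A\<close>,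
  then \<open>\<phi>\<^sub>J\<close> lies between the indicators of \<open>A\<close> and \<open>A\<^sup>r\<^sup>,\<^sup>t\<close>, so closeness of the finitely many
  integrals of the \<open>\<phi>\<^sub>J\<close> bounds the Prokhorov distance to the limit.

  The subbasic neighbourhoods of \<open>\<mu>\<close> are balls with an arbitrary centre \<open>\<nu>\<close>. They are reached
  with the triangle inequality, which needs a positive amount of time left for the distance
  from \<open>\<mu>\<close> to \<open>\<mu>\<^sub>i\<close>. This comes from the continuity of \<open>M\<close> in time, which is uniform on \<open>X \<times> X\<close>.
\<close>

section \<open>Two topological tools: convergence tested on a subbase, and uniform radii from
  compactness\<close>

text \<open>Eventual membership passes to finite intersections and to unions. The main theorem can
  therefore test subbasic balls directly, without first proving that \<open>fuzzy_prokhorov\<close>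
  is a fuzzy metric.\<close>

lemma limitin_topology_generated_byI:
  assumes "l \<in> \<Union>S" and S: "\<And>U. U \<in> S \<Longrightarrow> l \<in> U \<Longrightarrow> eventually (\<lambda>i. f i \<in> U) F"
  shows "limitin (topology_generated_by S) f l F"
  unfolding limitin_def
proof (intro conjI allI impI)
  show "l \<in> topspace (topology_generated_by S)" using assms(1) by simp
  fix U assume "openin (topology_generated_by S) U \<and> l \<in> U"
  then have "generate_topology_on S U" "l \<in> U" by (auto simp: openin_topology_generated_by)
  then show "eventually (\<lambda>i. f i \<in> U) F"
  proof induction
    case (Int a b)
    then show ?case by (simp add: eventually_conj_iff)
  next
    case (UN K)
    then obtain k where k: "k \<in> K" "l \<in> k" by blast
    then have "eventually (\<lambda>i. f i \<in> k) F" using UN.IH by blast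
    then show ?case by (rule eventually_mono) (use k in blast)
  qed (use S in auto)
qed

text \<open>A Lebesgue number argument: a finite subcover leaves finitely many local radii, and
  \<open>anti\<close> carries \<open>P\<close> down to their minimum.\<close>

lemma compact_space_uniform_radius:
  fixes P :: "real \<Rightarrow> 'b \<Rightarrow> bool"
  assumes T: "compact_space T"
    and loc: "\<And>p. p \<in> topspace T \<Longrightarrow> \<exists>U d. openin T U \<and> p \<in> U \<and> 0 < d \<and> (\<forall>q\<in>U. P d q)"
    and anti: "\<And>d e q. q \<in> topspace T \<Longrightarrow> 0 < d \<Longrightarrow> d \<le> e \<Longrightarrow> P e q \<Longrightarrow> P d q"
  shows "\<exists>d>0. \<forall>q\<in>topspace T. P d q"
proof -
  define \<U> where "\<U> = {U. openin T U \<and> (\<exists>d>0. \<forall>q\<in>U. P d q)}"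
  have "topspace T \<subseteq> \<Union>\<U>" unfolding \<U>_def using loc by blast
  moreover have "\<And>U. U \<in> \<U> \<Longrightarrow> openin T U" by (simp add: \<U>_def)
  ultimately obtain \<F> where F: "finite \<F>" "\<F> \<subseteq> \<U>" "topspace T \<subseteq> \<Union>\<F>"
    using T unfolding compact_space_alt by meson
  have "\<forall>U\<in>\<F>. \<exists>d>0. \<forall>q\<in>U. P d q" using F(2) by (auto simp: \<U>_def)
  then obtain d where d: "\<And>U. U \<in> \<F> \<Longrightarrow> 0 < d U \<and> (\<forall>q\<in>U. P (d U) q)" by metis
  \<comment> \<open>Inserting 1 keeps \<open>Min\<close> meaningful when the subcover is
    empty.\<close>
  define m where "m = Min (insert 1 (d ` \<F>))"
  have "0 < m" using F(1) d by (simp add: m_def)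
  moreover have "P m q" if q: "q \<in> topspace T" for q
  proof -
    obtain U where U: "U \<in> \<F>" "q \<in> U" using F(3) q by blast
    have "m \<le> d U" using F(1) U(1) by (simp add: m_def)
    then show ?thesis using anti[OF q \<open>0 < m\<close>] d U by blast
  qed
  ultimately show ?thesis by blast
qed

subsection \<open>Compact fuzzy metric spaces\<close>

lemma topspace_fuzzy_topology:
  assumes "fuzzy_metric_on X M"
  shows "topspace (fuzzy_topology X M) = X"
proof
  show "topspace (fuzzy_topology X M) \<subseteq> X"
    using openin_topspace[of "fuzzy_topology X M"]
    unfolding openin_fuzzy_topology_iff[OF assms] by blast
  have "fuzzy_ball X M x (1/2) 1 \<subseteq> X" for x by (auto simp: fuzzy_ball_def)
  then have "openin (fuzzy_topology X M) X"
    unfolding openin_fuzzy_topology_iff[OF assms]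
    by (intro conjI ballI exI[of _ "1/2"] exI[of _ 1]) auto
  then show "X \<subseteq> topspace (fuzzy_topology X M)" by (rule openin_subset)
qed

lemma openin_fuzzy_ball:
  assumes N: "fuzzy_metric_on X M" and "x \<in> X" "0 < t"
  shows "openin (fuzzy_topology X M) (fuzzy_ball X M x r t)"
  unfolding openin_fuzzy_topology_iff[OF N]
proof (intro conjI ballI)
  show "fuzzy_ball X M x r t \<subseteq> X" by (auto simp: fuzzy_ball_def)
qed (use fuzzy_ball_contains_ball[OF assms] in blast)

lemma openin_fuzzy_nbhd:
  assumes "fuzzy_metric_on X M" "A \<subseteq> X" "0 < t"
  shows "openin (fuzzy_topology X M) (fuzzy_nbhd X M A r t)"
  unfolding fuzzy_nbhd_def using assms by (auto intro!: openin_fuzzy_ball)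

text \<open>The truncated sum in \<open>luk_tnorm\<close> dominates the untruncated one, so the
  losses 1 - M simply add along a path, as do the times.\<close>

lemma fuzzy_metric_triangle:
  assumes N: "fuzzy_metric_on X M" and "x \<in> X" "y \<in> X" "z \<in> X" "0 < s" "0 < t"
  shows "M x y s + M y z t - 1 \<le> M x z (s + t)"
proof -
  have "luk_tnorm (M x y s) (M y z t) \<le> M x z (s + t)"
    using assms unfolding fuzzy_metric_on_def by blast
  then show ?thesis by (simp add: luk_tnorm_def)
qed

lemma fuzzy_metric_commute:
  "fuzzy_metric_on X M \<Longrightarrow> x \<in> X \<Longrightarrow> y \<in> X \<Longrightarrow> 0 < t \<Longrightarrow> M x y t = M y x t"
  unfolding fuzzy_metric_on_def by blast

lemma fuzzy_nbhd_fuzzy_nbhd_subset: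
  assumes N: "fuzzy_metric_on X M" and A: "A \<subseteq> X" and t: "0 < s" "0 < t"
  shows "fuzzy_nbhd X M (fuzzy_nbhd X M A q s) r t \<subseteq> fuzzy_nbhd X M A (q + r) (s + t)"
proof
  fix z assume "z \<in> fuzzy_nbhd X M (fuzzy_nbhd X M A q s) r t"
  then obtain x y where xy: "x \<in> A" "y \<in> X" "z \<in> X" "M x y s > 1 - q" "M y z t > 1 - r"
    by (auto simp: fuzzy_nbhd_def fuzzy_ball_def)
  then have "M x y s + M y z t - 1 \<le> M x z (s + t)"
    using A t by (intro fuzzy_metric_triangle[OF N]) auto
  then have "z \<in> fuzzy_ball X M x (q + r) (s + t)" using xy by (simp add: fuzzy_ball_def)
  then show "z \<in> fuzzy_nbhd X M A (q + r) (s + t)" using xy(1) by (auto simp: fuzzy_nbhd_def)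
qed

text \<open>Follow the path from x' through x and y to y': each of the two detours costs time d and
  a loss below e.\<close>

lemma fuzzy_metric_perturb:
  assumes N: "fuzzy_metric_on X M" and X: "x \<in> X" "y \<in> X" "x' \<in> X" "y' \<in> X"
    and t: "0 < t" "0 < d" and "M x x' d > 1 - e" "M y y' d > 1 - e"
  shows "M x y t < M x' y' (t + 2 * d) + 2 * e"
proof -
  have "M x' x d + M x y t - 1 \<le> M x' y (d + t)"
    using N X t by (intro fuzzy_metric_triangle) auto
  moreover have "M x' y (d + t) + M y y' d - 1 \<le> M x' y' (d + t + d)"
    using N X t by (intro fuzzy_metric_triangle) auto
  moreover have "M x' x d = M x x' d" using N X t by (intro fuzzy_metric_commute) auto
  moreover have "d + t + d = t + 2 * d" by simp
  ultimately show ?thesis using assms(8,9) by (simp only:)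
qed

text \<open>Continuity in time at t, with a symmetric window because moving points shifts the time
  in either direction; \<open>d < t\<close> keeps t - d positive.\<close>

lemma fuzzy_metric_oscillation:
  assumes N: "fuzzy_metric_on X M" and X: "x \<in> X" "y \<in> X" and t: "0 < t" and e: "0 < e"
  obtains d where "0 < d" "d < t" "M x y (t + d) < M x y (t - d) + e"
proof -
  have "continuous_on {0<..} (M x y)" using N X unfolding fuzzy_metric_on_def by blast
  then have "isCont (M x y) t" using t by (simp add: continuous_on_eq_continuous_at)
  then obtain r where r: "0 < r" "\<And>s. dist s t < r \<Longrightarrow> dist (M x y s) (M x y t) < e / 2"
    unfolding continuous_at_eps_delta using half_gt_zero[OF e] by meson
  define d where "d = min r t / 2"
  have d: "0 < d" "d < t" "d < r" using r t by (auto simp: d_def)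
  have "dist (M x y (t + d)) (M x y t) < e / 2" "dist (M x y (t - d)) (M x y t) < e / 2"
    by (rule r(2), use d in \<open>simp add: dist_real_def\<close>)+
  then have "M x y (t + d) < M x y (t - d) + e" unfolding dist_real_def by linarith
  with d that show ?thesis by blast
qed

text \<open>The uniform radius lemma on the compact product of X with itself, with the local
  hypothesis expressed through products of balls.\<close>

lemma fuzzy_metric_compact_uniform:
  assumes N: "fuzzy_metric_on X M" and C: "compact_space (fuzzy_topology X M)"
    and loc: "\<And>x y. x \<in> X \<Longrightarrow> y \<in> X \<Longrightarrow> \<exists>d e u. 0 < d \<and> 0 < e \<and> 0 < u \<and>
      (\<forall>x'\<in>X. \<forall>y'\<in>X. M x x' u > 1 - e \<longrightarrow> M y y' u > 1 - e \<longrightarrow> P d x' y')"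
    and anti: "\<And>d e x y. x \<in> X \<Longrightarrow> y \<in> X \<Longrightarrow> 0 < d \<Longrightarrow> d \<le> e \<Longrightarrow> P e x y \<Longrightarrow> P d x y"
  shows "\<exists>d>(0::real). \<forall>x\<in>X. \<forall>y\<in>X. P d x y"
proof -
  let ?T = "fuzzy_topology X M"
  have "\<exists>d>0. \<forall>q\<in>topspace (prod_topology ?T ?T). P d (fst q) (snd q)"
  proof (rule compact_space_uniform_radius)
    show "compact_space (prod_topology ?T ?T)" using C by (simp add: compact_space_prod_topology)
    fix p assume "p \<in> topspace (prod_topology ?T ?T)"
    then obtain x y where p: "p = (x, y)" "x \<in> X" "y \<in> X"
      by (auto simp: topspace_fuzzy_topology[OF N])
    obtain d e u where d: "0 < d" "0 < e" "0 < u"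
      "\<And>x' y'. x' \<in> X \<Longrightarrow> y' \<in> X \<Longrightarrow> M x x' u > 1 - e \<Longrightarrow> M y y' u > 1 - e \<Longrightarrow> P d x' y'"
      using loc[OF p(2,3)] by blast
    let ?U = "fuzzy_ball X M x e u \<times> fuzzy_ball X M y e u"
    have "openin (prod_topology ?T ?T) ?U"
      using N p d by (simp add: openin_prod_Times_iff openin_fuzzy_ball)
    moreover have "p \<in> ?U" using N p d by (simp add: fuzzy_ball_centre)
    moreover have "\<forall>q\<in>?U. P d (fst q) (snd q)" using d(4) by (auto simp: fuzzy_ball_def)
    ultimately show "\<exists>U d. openin (prod_topology ?T ?T) U \<and> p \<in> U \<and> 0 < d \<and>
        (\<forall>q\<in>U. P d (fst q) (snd q))"
      using d(1) by blast
  qed (use anti in \<open>auto simp: topspace_fuzzy_topology[OF N]\<close>)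
  then show ?thesis by (auto simp: topspace_fuzzy_topology[OF N])
qed

lemma compact_fuzzy_metric_bounded_below:
  assumes N: "fuzzy_metric_on X M" and C: "compact_space (fuzzy_topology X M)" and t: "0 < t"
  shows "\<exists>c>0. \<forall>x\<in>X. \<forall>y\<in>X. c \<le> M x y t"
proof (rule fuzzy_metric_compact_uniform[OF N C])
  fix x y assume X: "x \<in> X" "y \<in> X"
  \<comment> \<open>The value at time t/2 is 4e. Moving both points costs 2e and time 2 * (t/4), so
    more than 2e remains at time t.\<close>
  define e where "e = M x y (t / 2) / 4"
  have e: "0 < e" using N X t unfolding fuzzy_metric_on_def e_def by simp
  have "e \<le> M x' y' t"
    if "x' \<in> X" "y' \<in> X" "M x x' (t / 4) > 1 - e" "M y y' (t / 4) > 1 - e" for x' y'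
    using fuzzy_metric_perturb[OF N X that(1,2) _ _ that(3,4), of "t / 2"] t e
    by (simp add: e_def)
  then show "\<exists>d e u. 0 < d \<and> 0 < e \<and> 0 < u \<and>
      (\<forall>x'\<in>X. \<forall>y'\<in>X. M x x' u > 1 - e \<longrightarrow> M y y' u > 1 - e \<longrightarrow> d \<le> M x' y' t)"
    using e t by (intro exI[of _ e] exI[of _ "t / 4"]) auto
qed simp

text \<open>Local bounds come from continuity in time at a fixed pair, transferred to nearby pairs
  by \<open>fuzzy_metric_perturb\<close>; compactness makes them uniform.\<close>

lemma compact_fuzzy_metric_uniform_left_continuous:
  assumes N: "fuzzy_metric_on X M" and C: "compact_space (fuzzy_topology X M)"
    and t: "0 < t" and e: "0 < e"
  obtains s where "0 < s" "s < t" "\<And>x y. x \<in> X \<Longrightarrow> y \<in> X \<Longrightarrow> M x y t \<le> M x y s + e"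
proof -
  have "\<exists>d>0. \<forall>x\<in>X. \<forall>y\<in>X. d < t \<and> M x y t \<le> M x y (t - d) + e"
  proof (rule fuzzy_metric_compact_uniform[OF N C])
    fix x y assume X: "x \<in> X" "y \<in> X"
    \<comment> \<open>The budget of five parts: two for passing from (x', y') to (x, y), one for the
      oscillation in time, two for passing back. Each passage takes time 2d/3, so the upper time
      stays within t + d and the lower one ends at t - d/3.\<close>
    have "0 < e / 5" using e by simp
    then obtain d where d: "0 < d" "d < t" "M x y (t + d) < M x y (t - d) + e / 5"
      using fuzzy_metric_oscillation[OF N X t] by blast
    have "M x' y' t \<le> M x' y' (t - d / 3) + e"
      if X': "x' \<in> X" "y' \<in> X" and "M x x' (d / 3) > 1 - e / 5" "M y y' (d / 3) > 1 - e / 5"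
      for x' y'
    proof -
      have sym: "M x' x (d / 3) = M x x' (d / 3)" "M y' y (d / 3) = M y y' (d / 3)"
        using N X X' d by (auto intro: fuzzy_metric_commute)
      have "M x' y' t < M x y (t + 2 * (d / 3)) + 2 * (e / 5)"
        using N X X' t d that sym by (intro fuzzy_metric_perturb) auto
      moreover have "M x y (t + 2 * (d / 3)) \<le> M x y (t + d)"
        using t d by (intro fuzzy_metric_on_mono[OF N X]) auto
      moreover have "M x y (t - d) < M x' y' (t - d + 2 * (d / 3)) + 2 * (e / 5)"
        using N X X' d that by (intro fuzzy_metric_perturb) auto
      moreover have "t - d + 2 * (d / 3) = t - d / 3" by simp
      ultimately show ?thesis using d(3) by simp
    qed
    then show "\<exists>d e' u. 0 < d \<and> 0 < e' \<and> 0 < u \<and> (\<forall>x'\<in>X. \<forall>y'\<in>X. M x x' u > 1 - e' \<longrightarrow>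
        M y y' u > 1 - e' \<longrightarrow> d < t \<and> M x' y' t \<le> M x' y' (t - d) + e)"
      using d e by (intro exI[of _ "d / 3"] exI[of _ "e / 5"]) auto
  next
    fix d d' x y assume *: "x \<in> X" "y \<in> X" "0 < d" "d \<le> d'"
      "d' < t \<and> M x y t \<le> M x y (t - d') + e"
    have "M x y (t - d') \<le> M x y (t - d)" using * by (intro fuzzy_metric_on_mono[OF N]) auto
    then show "d < t \<and> M x y t \<le> M x y (t - d) + e" using * by auto
  qed
  then obtain d where d: "0 < d" "\<And>x y. x \<in> X \<Longrightarrow> y \<in> X \<Longrightarrow> d < t \<and> M x y t \<le> M x y (t - d) + e"
    by blast
  show ?thesis
  \<comment> \<open>Over an empty X the uniform statement does not yield
    \<open>d < t\<close>.\<close>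
  proof (cases "X = {}")
    case True
    then show ?thesis using that[of "t / 2"] t by auto
  next
    case False
    then have "d < t" using d(2) by blast
    then show ?thesis using that[of "t - d"] d by auto
  qed
qed

text \<open>For z near y, two triangle inequalities squeeze M x z t between M x y (t - d) and M x y
  (t + d) up to a small loss. These maps are the building blocks of the test functions.\<close>

lemma continuous_map_fuzzy_metric:
  assumes N: "fuzzy_metric_on X M" and x: "x \<in> X" and t: "0 < t"
  shows "continuous_map (fuzzy_topology X M) euclideanreal (\<lambda>y. M x y t)"
  unfolding continuous_map_def topspace_fuzzy_topology[OF N] openin_fuzzy_topology_iff[OF N]
proof (intro conjI allI impI ballI)
  fix U y assume U: "openin euclideanreal U" and y: "y \<in> {y \<in> X. M x y t \<in> U}"
  then obtain e where e: "0 < e" "\<And>v. dist v (M x y t) < e \<Longrightarrow> v \<in> U"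
    unfolding open_openin[symmetric] open_dist by blast
  have yX: "y \<in> X" using y by simp
  have e2: "0 < e / 2" using e by simp
  obtain d where d: "0 < d" "d < t" "M x y (t + d) < M x y (t - d) + e / 2"
    using fuzzy_metric_oscillation[OF N x yX t e2] by blast
  define r where "r = min (e / 2) (1 / 2)"
  have "fuzzy_ball X M y r d \<subseteq> {y \<in> X. M x y t \<in> U}"
  proof
    fix z assume "z \<in> fuzzy_ball X M y r d"
    then have z: "z \<in> X" "M y z d > 1 - r" by (auto simp: fuzzy_ball_def)
    have "M x y (t - d) + M y z d - 1 \<le> M x z (t - d + d)"
      using N x yX z d by (intro fuzzy_metric_triangle) auto
    moreover have "M x z t + M z y d - 1 \<le> M x y (t + d)"
      using N x yX z d t by (intro fuzzy_metric_triangle) auto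
    moreover have "M z y d = M y z d" using N yX z d by (intro fuzzy_metric_commute) auto
    moreover have "M x y (t - d) \<le> M x y t" "M x y t \<le> M x y (t + d)"
      using d t by (auto intro: fuzzy_metric_on_mono[OF N x yX])
    moreover have "r \<le> e / 2" by (simp add: r_def)
    ultimately have "dist (M x z t) (M x y t) < e"
      using d(3) z(2) by (simp add: dist_real_def)
    then show "z \<in> {y \<in> X. M x y t \<in> U}" using e(2) z by simp
  qed
  moreover have "0 < r" "r < 1" using e by (auto simp: r_def)
  ultimately show "\<exists>r u. 0 < r \<and> r < 1 \<and> 0 < u \<and> fuzzy_ball X M y r u \<subseteq> {y \<in> X. M x y t \<in> U}"
    using d(1) by blast
qed auto

subsection \<open>Borel sets and integrals\<close>

lemma sets_fuzzy_borel:
  assumes "fuzzy_metric_on X M"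
  shows "sets (fuzzy_borel X M) = sigma_sets X {U. openin (fuzzy_topology X M) U}"
proof -
  have "{U. openin (fuzzy_topology X M) U} \<subseteq> Pow X"
    using openin_subset topspace_fuzzy_topology[OF assms] by blast
  then show ?thesis unfolding fuzzy_borel_def by (rule sets_measure_of)
qed

lemma openin_in_sets_fuzzy_borel:
  assumes "fuzzy_metric_on X M" "openin (fuzzy_topology X M) U"
  shows "U \<in> sets (fuzzy_borel X M)"
  unfolding sets_fuzzy_borel[OF assms(1)] using assms(2) by (intro sigma_sets.Basic) simp

lemma fuzzy_borel_subset:
  assumes "A \<in> sets (fuzzy_borel X M)" "fuzzy_metric_on X M"
  shows "A \<subseteq> X"
  using assms(1) unfolding sets_fuzzy_borel[OF assms(2)]
  by (rule sigma_sets_into_sp[rotated])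
    (use openin_subset topspace_fuzzy_topology[OF assms(2)] in blast)

lemma fuzzy_nbhd_in_sets:
  assumes "fuzzy_metric_on X M" "A \<in> sets (fuzzy_borel X M)" "0 < t"
  shows "fuzzy_nbhd X M A r t \<in> sets (fuzzy_borel X M)"
  using assms fuzzy_borel_subset by (blast intro: openin_in_sets_fuzzy_borel openin_fuzzy_nbhd)

lemma borel_prob_measures_mono:
  assumes "\<mu> \<in> borel_prob_measures X M" "B \<in> sets (fuzzy_borel X M)" "A \<subseteq> B"
  shows "measure \<mu> A \<le> measure \<mu> B"
proof -
  interpret prob_space \<mu> using assms by (simp add: borel_prob_measures_def)
  show ?thesis using assms by (intro finite_measure_mono) (auto simp: borel_prob_measures_def)
qed

lemma continuous_map_borel_measurable:
  assumes N: "fuzzy_metric_on X M" and \<mu>: "\<mu> \<in> borel_prob_measures X M"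
    and \<phi>: "continuous_map (fuzzy_topology X M) euclideanreal \<phi>"
  shows "\<phi> \<in> borel_measurable \<mu>"
proof (rule borel_measurableI)
  fix S :: "real set" assume "open S"
  then have "openin (fuzzy_topology X M) {x \<in> X. \<phi> x \<in> S}"
    using openin_continuous_map_preimage[OF \<phi>] by (simp add: topspace_fuzzy_topology[OF N])
  moreover have "\<phi> -` S \<inter> space \<mu> = {x \<in> X. \<phi> x \<in> S}"
    using \<mu> by (auto simp: borel_prob_measures_def)
  ultimately show "\<phi> -` S \<inter> space \<mu> \<in> sets \<mu>"
    using openin_in_sets_fuzzy_borel[OF N] \<mu> by (simp add: borel_prob_measures_def)
qed

text \<open>The function lies between the indicators of A and B on X, so monotonicity of the
  integral turns information on integrals into bounds on measures.\<close>

lemma integral_between_measures: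
  assumes N: "fuzzy_metric_on X M" and \<mu>: "\<mu> \<in> borel_prob_measures X M"
    and \<phi>: "continuous_map (fuzzy_topology X M) euclideanreal \<phi>"
    and bd: "\<And>x. x \<in> X \<Longrightarrow> 0 \<le> \<phi> x \<and> \<phi> x \<le> 1"
    and AB: "A \<in> sets (fuzzy_borel X M)" "B \<in> sets (fuzzy_borel X M)"
    and A: "\<And>x. x \<in> A \<Longrightarrow> \<phi> x = 1" and B: "\<And>x. x \<in> X - B \<Longrightarrow> \<phi> x = 0"
  shows "measure \<mu> A \<le> integral\<^sup>L \<mu> \<phi>" "integral\<^sup>L \<mu> \<phi> \<le> measure \<mu> B"
proof -
  interpret prob_space \<mu> using \<mu> by (simp add: borel_prob_measures_def)
  have sp: "space \<mu> = X" and S: "A \<in> sets \<mu>" "B \<in> sets \<mu>"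
    using \<mu> AB by (auto simp: borel_prob_measures_def)
  have int: "integrable \<mu> \<phi>"
    using bd continuous_map_borel_measurable[OF N \<mu> \<phi>]
    by (intro integrable_const_bound[of _ 1]) (auto simp: sp)
  have iA: "integrable \<mu> (indicat_real A)" and iB: "integrable \<mu> (indicat_real B)"
    using S by (auto intro!: integrable_real_indicator simp: less_top[symmetric])
  have "measure \<mu> A = integral\<^sup>L \<mu> (indicat_real A)" using S by simp
  also have "\<dots> \<le> integral\<^sup>L \<mu> \<phi>"
    using bd A by (intro integral_mono[OF iA int]) (auto simp: sp indicator_def)
  finally show "measure \<mu> A \<le> integral\<^sup>L \<mu> \<phi>" .
  have "integral\<^sup>L \<mu> \<phi> \<le> integral\<^sup>L \<mu> (indicat_real B)"
    using bd B by (intro integral_mono[OF int iB]) (auto simp: sp indicator_def)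
  also have "\<dots> = measure \<mu> B" using S by simp
  finally show "integral\<^sup>L \<mu> \<phi> \<le> measure \<mu> B" .
qed

subsection \<open>The Prokhorov radii\<close>

text \<open>Naming the set under the infimum of \<open>fuzzy_prokhorov\<close> allows arguments
  about individual admissible radii instead of infima.\<close>

definition prokhorov_radii ::
    "'a set \<Rightarrow> ('a \<Rightarrow> 'a \<Rightarrow> real \<Rightarrow> real) \<Rightarrow> 'a measure \<Rightarrow> 'a measure \<Rightarrow> real \<Rightarrow> real set" where
  "prokhorov_radii X M \<mu> \<nu> t =
     {r. 0 < r \<and> r < 1 \<and>
         (\<forall>A\<in>sets (fuzzy_borel X M).
            measure \<mu> A \<le> measure \<nu> (fuzzy_nbhd X M A r t) + r \<and>
            measure \<nu> A \<le> measure \<mu> (fuzzy_nbhd X M A r t) + r)}"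

lemma fuzzy_prokhorov_eq: "fuzzy_prokhorov X M \<mu> \<nu> t = 1 - Inf (prokhorov_radii X M \<mu> \<nu> t)"
  by (simp add: fuzzy_prokhorov_def prokhorov_radii_def)

lemma fuzzy_prokhorov_ge:
  assumes "r \<in> prokhorov_radii X M \<mu> \<nu> t"
  shows "1 - r \<le> fuzzy_prokhorov X M \<mu> \<nu> t"
proof -
  have "bdd_below (prokhorov_radii X M \<mu> \<nu> t)"
    by (rule bdd_belowI[of _ 0]) (simp add: prokhorov_radii_def)
  then have "Inf (prokhorov_radii X M \<mu> \<nu> t) \<le> r" using assms by (intro cInf_lower)
  then show ?thesis by (simp add: fuzzy_prokhorov_eq)
qed

text \<open>Once 1 - r is below a lower bound of M at time t, every ball of radius r is all of X.
  Nonemptiness is what lets a strict upper bound on the infimum produce an actual radius.\<close>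

lemma prokhorov_radii_nonempty:
  assumes N: "fuzzy_metric_on X M" and C: "compact_space (fuzzy_topology X M)" and t: "0 < t"
    and \<mu>: "\<mu> \<in> borel_prob_measures X M" and \<nu>: "\<nu> \<in> borel_prob_measures X M"
  shows "prokhorov_radii X M \<mu> \<nu> t \<noteq> {}"
proof -
  interpret \<mu>: prob_space \<mu> using \<mu> by (simp add: borel_prob_measures_def)
  interpret \<nu>: prob_space \<nu> using \<nu> by (simp add: borel_prob_measures_def)
  have sp: "space \<mu> = X" "space \<nu> = X" using \<mu> \<nu> by (auto simp: borel_prob_measures_def)
  obtain c where c: "0 < c" "\<And>x y. x \<in> X \<Longrightarrow> y \<in> X \<Longrightarrow> c \<le> M x y t"
    using compact_fuzzy_metric_bounded_below[OF N C t] by blast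
  \<comment> \<open>Halving gives 1 - r < c strictly; the minimum with 1 keeps r positive.\<close>
  define r where "r = 1 - min c 1 / 2"
  have r: "0 < r" "r < 1" "1 - r < c" using c(1) by (auto simp: r_def)
  have nb: "fuzzy_nbhd X M A r t = X" if A: "A \<subseteq> X" "A \<noteq> {}" for A
  proof
    show "fuzzy_nbhd X M A r t \<subseteq> X" by (auto simp: fuzzy_nbhd_def fuzzy_ball_def)
    obtain a where "a \<in> A" using A by blast
    moreover have "X \<subseteq> fuzzy_ball X M a r t"
    proof
      fix y assume "y \<in> X"
      then show "y \<in> fuzzy_ball X M a r t"
        using c(2)[of a y] r A \<open>a \<in> A\<close> by (auto simp: fuzzy_ball_def)
    qed
    ultimately show "X \<subseteq> fuzzy_nbhd X M A r t" by (auto simp: fuzzy_nbhd_def)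
  qed
  have "measure \<mu> A \<le> measure \<nu> (fuzzy_nbhd X M A r t) + r \<and>
      measure \<nu> A \<le> measure \<mu> (fuzzy_nbhd X M A r t) + r" if "A \<in> sets (fuzzy_borel X M)" for A
  proof (cases "A = {}")
    case True
    then show ?thesis using r by (simp add: fuzzy_nbhd_def)
  next
    case False
    have "fuzzy_nbhd X M A r t = X" using nb fuzzy_borel_subset[OF that N] False by blast
    moreover have "measure \<mu> X = 1" "measure \<nu> X = 1" using \<mu>.prob_space \<nu>.prob_space sp by auto
    ultimately show ?thesis
      using \<mu>.prob_le_1[of A] \<nu>.prob_le_1[of A] r(1) by (auto intro: order_trans)
  qed
  then have "r \<in> prokhorov_radii X M \<mu> \<nu> t" using r by (simp add: prokhorov_radii_def)
  then show ?thesis by blast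
qed

text \<open>Slack in the radius is traded for slack in time: if M drops by at most q - r between t
  and s, the (r, t)-neighbourhood of A lies in its (q, s)-neighbourhood.\<close>

lemma prokhorov_radii_left:
  assumes N: "fuzzy_metric_on X M" and C: "compact_space (fuzzy_topology X M)" and t: "0 < t"
    and \<mu>: "\<mu> \<in> borel_prob_measures X M" and \<nu>: "\<nu> \<in> borel_prob_measures X M"
    and r: "r \<in> prokhorov_radii X M \<mu> \<nu> t" and q: "r < q" "q < 1"
  obtains s where "0 < s" "s < t" "q \<in> prokhorov_radii X M \<mu> \<nu> s"
proof -
  have "0 < q - r" using q by simp
  then obtain s where s: "0 < s" "s < t"
    "\<And>x y. x \<in> X \<Longrightarrow> y \<in> X \<Longrightarrow> M x y t \<le> M x y s + (q - r)"
    using compact_fuzzy_metric_uniform_left_continuous[OF N C t] by blast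
  have "measure \<mu> A \<le> measure \<nu> (fuzzy_nbhd X M A q s) + q \<and>
      measure \<nu> A \<le> measure \<mu> (fuzzy_nbhd X M A q s) + q" if A: "A \<in> sets (fuzzy_borel X M)" for A
  proof -
    have "fuzzy_nbhd X M A r t \<subseteq> fuzzy_nbhd X M A q s"
    proof
      fix y assume "y \<in> fuzzy_nbhd X M A r t"
      then obtain x where x: "x \<in> A" "y \<in> X" "M x y t > 1 - r"
        by (auto simp: fuzzy_nbhd_def fuzzy_ball_def)
      then have "M x y t \<le> M x y s + (q - r)" using s(3) fuzzy_borel_subset[OF A N] by blast
      then show "y \<in> fuzzy_nbhd X M A q s" using x by (force simp: fuzzy_nbhd_def fuzzy_ball_def)
    qed
    then have "measure \<mu> (fuzzy_nbhd X M A r t) \<le> measure \<mu> (fuzzy_nbhd X M A q s)"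
      "measure \<nu> (fuzzy_nbhd X M A r t) \<le> measure \<nu> (fuzzy_nbhd X M A q s)"
      using \<mu> \<nu> fuzzy_nbhd_in_sets[OF N A s(1)] by (auto intro: borel_prob_measures_mono)
    moreover have "measure \<mu> A \<le> measure \<nu> (fuzzy_nbhd X M A r t) + r"
      "measure \<nu> A \<le> measure \<mu> (fuzzy_nbhd X M A r t) + r"
      using r A by (auto simp: prokhorov_radii_def)
    ultimately show ?thesis using q(1) by linarith
  qed
  then have "q \<in> prokhorov_radii X M \<mu> \<nu> s" using r q by (simp add: prokhorov_radii_def)
  with s that show ?thesis by blast
qed

text \<open>Neighbourhoods of Borel sets are open, so the defining inequalities apply to them again.
  One bound enlarges A by (q, s) and then (r, t), the other in the opposite order.\<close>

lemma prokhorov_radii_triangle: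
  assumes N: "fuzzy_metric_on X M" and t: "0 < s" "0 < t"
    and \<mu>: "\<mu> \<in> borel_prob_measures X M" and \<nu>: "\<nu> \<in> borel_prob_measures X M"
    and q: "q \<in> prokhorov_radii X M \<mu> \<rho> s" and r: "r \<in> prokhorov_radii X M \<rho> \<nu> t"
    and qr: "q + r < 1"
  shows "q + r \<in> prokhorov_radii X M \<mu> \<nu> (s + t)"
proof -
  note sub = fuzzy_nbhd_fuzzy_nbhd_subset[OF N fuzzy_borel_subset[OF _ N]]
  have "measure \<mu> A \<le> measure \<nu> (fuzzy_nbhd X M A (q + r) (s + t)) + (q + r) \<and>
      measure \<nu> A \<le> measure \<mu> (fuzzy_nbhd X M A (q + r) (s + t)) + (q + r)"
    if A: "A \<in> sets (fuzzy_borel X M)" for A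
  proof -
    note n = fuzzy_nbhd_in_sets[OF N A]
    have "measure \<mu> A \<le> measure \<rho> (fuzzy_nbhd X M A q s) + q"
      "measure \<nu> A \<le> measure \<rho> (fuzzy_nbhd X M A r t) + r"
      using q r A by (auto simp: prokhorov_radii_def)
    moreover have "measure \<rho> (fuzzy_nbhd X M A q s) \<le>
        measure \<nu> (fuzzy_nbhd X M (fuzzy_nbhd X M A q s) r t) + r"
      "measure \<rho> (fuzzy_nbhd X M A r t) \<le>
        measure \<mu> (fuzzy_nbhd X M (fuzzy_nbhd X M A r t) q s) + q"
      using q r n t by (auto simp: prokhorov_radii_def)
    moreover have "measure \<nu> (fuzzy_nbhd X M (fuzzy_nbhd X M A q s) r t) \<le>
        measure \<nu> (fuzzy_nbhd X M A (q + r) (s + t))"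
      "measure \<mu> (fuzzy_nbhd X M (fuzzy_nbhd X M A r t) q s) \<le>
        measure \<mu> (fuzzy_nbhd X M A (q + r) (s + t))"
      using t sub[OF A t, of q r] sub[OF A t(2,1), of r q]
      by (auto intro!: borel_prob_measures_mono[OF \<nu> n] borel_prob_measures_mono[OF \<mu> n]
          simp only: add.commute)
    ultimately show ?thesis by linarith
  qed
  then show ?thesis using q r qr by (simp add: prokhorov_radii_def)
qed

text \<open>Serves to place the limit measure in the topological space of
  \<open>fuzzy_prokhorov\<close>.\<close>

lemma prokhorov_radii_self:
  assumes N: "fuzzy_metric_on X M" and t: "0 < t" and \<mu>: "\<mu> \<in> borel_prob_measures X M"
    and r: "0 < r" "r < 1"
  shows "r \<in> prokhorov_radii X M \<mu> \<mu> t"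
proof -
  have "measure \<mu> A \<le> measure \<mu> (fuzzy_nbhd X M A r t)" if A: "A \<in> sets (fuzzy_borel X M)" for A
  proof -
    have "A \<subseteq> fuzzy_nbhd X M A r t"
      using fuzzy_borel_subset[OF A N] fuzzy_ball_centre[OF N _ r(1) t]
      by (auto simp: fuzzy_nbhd_def)
    then show ?thesis using \<mu> fuzzy_nbhd_in_sets[OF N A t] by (intro borel_prob_measures_mono)
  qed
  then have "measure \<mu> A \<le> measure \<mu> (fuzzy_nbhd X M A r t) + r"
    if "A \<in> sets (fuzzy_borel X M)" for A
    using that r(1) by (meson add_increasing2 less_imp_le)
  then show ?thesis using r by (simp add: prokhorov_radii_def)
qed

section \<open>From weak* convergence to small Prokhorov radii\<close>

text \<open>The test functions are fixed before A and indexed by subsets of a finite K, so a single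
  threshold for i serves all Borel sets A.\<close>

lemma weak_star_eventually_prokhorov_radii:
  assumes N: "fuzzy_metric_on X M" and C: "compact_space (fuzzy_topology X M)"
    and \<mu>: "\<mu> \<in> borel_prob_measures X M" and \<mu>s: "\<And>i. \<mu>s i \<in> borel_prob_measures X M"
    and W: "weak_star_converges X M \<mu>s \<mu>"
    and r: "0 < r" "r < 1" and t: "0 < t"
  shows "eventually (\<lambda>i. r \<in> prokhorov_radii X M \<mu> (\<mu>s i) t) sequentially"
proof -
  let ?T = "fuzzy_topology X M"
  let ?B = "\<lambda>x. fuzzy_ball X M x (r / 4) (t / 2)"
  have t2: "0 < t / 2" and r4: "0 < r / 4" using t r by auto
  have "topspace ?T \<subseteq> \<Union>(?B ` X)"
    using fuzzy_ball_centre[OF N _ r4 t2] by (auto simp: topspace_fuzzy_topology[OF N])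
  moreover have "\<And>U. U \<in> ?B ` X \<Longrightarrow> openin ?T U" using openin_fuzzy_ball[OF N _ t2] by blast
  ultimately obtain \<F> where F: "finite \<F>" "\<F> \<subseteq> ?B ` X" "topspace ?T \<subseteq> \<Union>\<F>"
    using C unfolding compact_space_alt by meson
  obtain K where K: "K \<subseteq> X" "finite K" "\<F> = ?B ` K"
    using finite_subset_image[OF F(1,2)] by blast
  \<comment> \<open>The summand of c vanishes off B(c, r/2, t/2), and the slope 4/r makes it at
    least 1 on B(c, r/4, t/2). Summing and cutting at 1 handles the whole union.\<close>
  define \<phi> where "\<phi> = (\<lambda>J y. min 1 (\<Sum>c\<in>J. max 0 (4 / r * (M c y (t / 2) - (1 - r / 2)))))"
  have cont: "continuous_map ?T euclideanreal (\<phi> J)" if "J \<subseteq> K" for J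
    unfolding \<phi>_def
    using that K finite_subset[OF that]
    by (intro continuous_intros continuous_map_real_min continuous_map_real_max
        continuous_map_real_mult_left continuous_map_diff continuous_map_sum
        continuous_map_fuzzy_metric[OF N] t2) auto
  have bd: "0 \<le> \<phi> J y \<and> \<phi> J y \<le> 1" for J y
    unfolding \<phi>_def by (auto intro!: sum_nonneg)
  have ev: "eventually (\<lambda>i. \<forall>J\<in>Pow K. \<bar>integral\<^sup>L (\<mu>s i) (\<phi> J) - integral\<^sup>L \<mu> (\<phi> J)\<bar> < r) sequentially"
  proof (intro eventually_ball_finite ballI)
    show "finite (Pow K)" using K by simp
    fix J assume "J \<in> Pow K"
    then have "(\<lambda>i. integral\<^sup>L (\<mu>s i) (\<phi> J)) \<longlonglongrightarrow> integral\<^sup>L \<mu> (\<phi> J)"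
      using W cont unfolding weak_star_converges_def by blast
    then show "eventually (\<lambda>i. \<bar>integral\<^sup>L (\<mu>s i) (\<phi> J) - integral\<^sup>L \<mu> (\<phi> J)\<bar> < r) sequentially"
      using r(1) by (auto simp: tendsto_iff dist_real_def)
  qed
  have *: "\<exists>J\<in>Pow K. \<forall>\<nu>\<in>borel_prob_measures X M. measure \<nu> A \<le> integral\<^sup>L \<nu> (\<phi> J) \<and>
      integral\<^sup>L \<nu> (\<phi> J) \<le> measure \<nu> (fuzzy_nbhd X M A r t)"
    if A: "A \<in> sets (fuzzy_borel X M)" for A
  proof
    define J where "J = {c \<in> K. ?B c \<inter> A \<noteq> {}}"
    show JK: "J \<in> Pow K" by (auto simp: J_def)
    then have J: "finite J" "J \<subseteq> X" using K finite_subset by auto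
    have AX: "A \<subseteq> X" by (rule fuzzy_borel_subset[OF A N])
    have one: "\<phi> J a = 1" if a: "a \<in> A" for a
    proof -
      have "a \<in> topspace ?T" using a AX topspace_fuzzy_topology[OF N] by blast
      then obtain c where c: "c \<in> K" "a \<in> ?B c" using F(3) K(3) by blast
      then have cJ: "c \<in> J" using a by (auto simp: J_def)
      have "M c a (t / 2) - (1 - r / 2) \<ge> r / 4" using c(2) by (simp add: fuzzy_ball_def)
      then have "4 / r * (r / 4) \<le> 4 / r * (M c a (t / 2) - (1 - r / 2))"
        using r by (intro mult_left_mono) auto
      then have "1 \<le> max 0 (4 / r * (M c a (t / 2) - (1 - r / 2)))" using r by simp
      also have "\<dots> \<le> (\<Sum>c\<in>J. max 0 (4 / r * (M c a (t / 2) - (1 - r / 2))))"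
        using J cJ by (intro member_le_sum) auto
      finally show ?thesis by (simp add: \<phi>_def)
    qed
    have zero: "\<phi> J y = 0" if y: "y \<in> X - fuzzy_nbhd X M A r t" for y
    proof -
      have "M c y (t / 2) \<le> 1 - r / 2" if cJ: "c \<in> J" for c
      proof (rule ccontr)
        assume "\<not> ?thesis"
        then have cy: "M c y (t / 2) > 1 - r / 2" by simp
        obtain a where a: "a \<in> A" "a \<in> ?B c" using cJ by (auto simp: J_def)
        have X: "c \<in> X" "a \<in> X" "y \<in> X" using cJ J a AX y by auto
        have "M a c (t / 2) > 1 - r / 4"
          using fuzzy_metric_commute[OF N X(1,2) t2] a by (simp add: fuzzy_ball_def)
        \<comment> \<open>The losses r/4 from a to c and r/2 from c to y add up to less than
          r.\<close>
        then have "M a y (t / 2 + t / 2) > 1 - r"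
          using fuzzy_metric_triangle[OF N X(2,1,3) t2 t2] cy r by linarith
        then have "y \<in> fuzzy_nbhd X M A r t"
          using a X by (auto simp: fuzzy_nbhd_def fuzzy_ball_def)
        then show False using y by simp
      qed
      then have "4 / r * (M c y (t / 2) - (1 - r / 2)) \<le> 0" if "c \<in> J" for c
        using that r by (intro mult_nonneg_nonpos) auto
      then have "(\<Sum>c\<in>J. max 0 (4 / r * (M c y (t / 2) - (1 - r / 2)))) = 0"
        by (intro sum.neutral ballI) (simp only: max_absorb1)
      then show ?thesis by (simp add: \<phi>_def)
    qed
    show "\<forall>\<nu>\<in>borel_prob_measures X M. measure \<nu> A \<le> integral\<^sup>L \<nu> (\<phi> J) \<and>
        integral\<^sup>L \<nu> (\<phi> J) \<le> measure \<nu> (fuzzy_nbhd X M A r t)"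
      using integral_between_measures[OF N _ cont bd A fuzzy_nbhd_in_sets[OF N A t] one zero] JK
      by blast
  qed
  show ?thesis
    using ev
  proof eventually_elim
    case (elim i)
    have "measure \<mu> A \<le> measure (\<mu>s i) (fuzzy_nbhd X M A r t) + r \<and>
        measure (\<mu>s i) A \<le> measure \<mu> (fuzzy_nbhd X M A r t) + r"
      if A: "A \<in> sets (fuzzy_borel X M)" for A
    proof -
      obtain J where J: "J \<in> Pow K" "\<And>\<nu>. \<nu> \<in> borel_prob_measures X M \<Longrightarrow>
          measure \<nu> A \<le> integral\<^sup>L \<nu> (\<phi> J) \<and>
          integral\<^sup>L \<nu> (\<phi> J) \<le> measure \<nu> (fuzzy_nbhd X M A r t)"
        using *[OF A] by blast
      \<comment> \<open>Chain: the measure of A is at most one integral, which is within r of the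
        other, which is at most the other measure of the neighbourhood. The absolute value gives
        both directions.\<close>
      have "\<bar>integral\<^sup>L (\<mu>s i) (\<phi> J) - integral\<^sup>L \<mu> (\<phi> J)\<bar> < r" using elim J(1) by blast
      then show ?thesis using J(2)[OF \<mu>] J(2)[OF \<mu>s[of i]] by linarith
    qed
    then show ?case using r by (simp add: prokhorov_radii_def)
  qed
qed

section \<open>Convergence in the topology of the fuzzy Prokhorov metric\<close>

theorem theorem3p8:
  fixes X :: "'a set"
    and M :: "'a \<Rightarrow> 'a \<Rightarrow> real \<Rightarrow> real"
    and \<mu> :: "'a measure"
    and \<mu>s :: "nat \<Rightarrow> 'a measure"
  assumes "fuzzy_metric_on X M"
    and "compact_space (fuzzy_topology X M)"
    and "\<mu> \<in> borel_prob_measures X M"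
    and "\<And>i. \<mu>s i \<in> borel_prob_measures X M"
    and "weak_star_converges X M \<mu>s \<mu>"
  shows "limitin (fuzzy_topology (borel_prob_measures X M) (fuzzy_prokhorov X M)) \<mu>s \<mu> sequentially"
  unfolding fuzzy_topology_def[of "borel_prob_measures X M"]
proof (rule limitin_topology_generated_byI)
  let ?P = "borel_prob_measures X M"
  let ?N = "fuzzy_prokhorov X M"
  let ?S = "{fuzzy_ball ?P ?N x r t | x r t. x \<in> ?P \<and> 0 < r \<and> r < 1 \<and> 0 < t}"
  note N = assms(1) and C = assms(2) and \<mu> = assms(3) and \<mu>s = assms(4)
  have "1 / 4 \<in> prokhorov_radii X M \<mu> \<mu> 1" using N \<mu> by (intro prokhorov_radii_self) auto
  then have "\<mu> \<in> fuzzy_ball ?P ?N \<mu> (1 / 2) 1"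
    using fuzzy_prokhorov_ge[of "1 / 4" X M \<mu> \<mu> 1] \<mu> by (simp add: fuzzy_ball_def)
  moreover have "fuzzy_ball ?P ?N \<mu> (1 / 2) 1 \<in> ?S"
    using \<mu> by (intro CollectI exI[of _ \<mu>] exI[of _ "1 / 2"] exI[of _ 1]) simp
  ultimately show "\<mu> \<in> \<Union>?S" by blast
  fix U assume "U \<in> ?S" and "\<mu> \<in> U"
  then obtain \<nu> r t where U: "U = fuzzy_ball ?P ?N \<nu> r t" "\<nu> \<in> ?P" "0 < r" "r < 1" "0 < t"
    and "?N \<nu> \<mu> t > 1 - r"
    by (auto simp: fuzzy_ball_def)
  then have "Inf (prokhorov_radii X M \<nu> \<mu> t) < r" by (simp add: fuzzy_prokhorov_eq)
  then obtain p where p: "p \<in> prokhorov_radii X M \<nu> \<mu> t" "p < r"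
    using cInf_lessD prokhorov_radii_nonempty[OF N C U(5,2) \<mu>] by blast
  \<comment> \<open>The gap r - p is split: q - p buys the spare time t - s, and r - q leaves room
    for the distance from \<open>\<mu>\<close> to \<open>\<mu>s i\<close>.\<close>
  obtain q where q: "p < q" "q < r" using dense[OF p(2)] by blast
  then have "q < 1" using U by simp
  then obtain s where s: "0 < s" "s < t" "q \<in> prokhorov_radii X M \<nu> \<mu> s"
    using prokhorov_radii_left[OF N C U(5,2) \<mu> p(1) q(1)] by blast
  \<comment> \<open>Half of the gap keeps q + d strictly below r, as needed because
    \<open>fuzzy_prokhorov_ge\<close> is not strict while the ball is.\<close>
  define d where "d = (r - q) / 2"
  have "0 < q" using s(3) by (simp add: prokhorov_radii_def)
  then have d: "0 < d" "d < 1" "q + d < r" "q + d < 1" using q U by (auto simp: d_def field_simps)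
  have "0 < t - s" using s by simp
  then have "eventually (\<lambda>i. d \<in> prokhorov_radii X M \<mu> (\<mu>s i) (t - s)) sequentially"
    by (rule weak_star_eventually_prokhorov_radii[OF N C \<mu> \<mu>s assms(5) d(1,2)])
  then show "eventually (\<lambda>i. \<mu>s i \<in> U) sequentially"
  proof eventually_elim
    case (elim i)
    have "q + d \<in> prokhorov_radii X M \<nu> (\<mu>s i) (s + (t - s))"
      by (rule prokhorov_radii_triangle[OF N s(1) \<open>0 < t - s\<close> U(2) \<mu>s s(3) elim d(4)])
    then have "1 - (q + d) \<le> ?N \<nu> (\<mu>s i) t" using fuzzy_prokhorov_ge by simp
    then show ?case using d(3) \<mu>s by (simp add: U(1) fuzzy_ball_def)
  qed
qed

end
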